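(* Let $(\lambda_1,\lambda_2)\in[0.9,1]^2$ and $x\in[-1,1]$. Let $(u_n)_{n\ge 0}$ (real numbers) and $(b_n)_{n\ge 1}$ (in $\{-1,1\}$) be produced by the leaky golden ratio encoder $$u_0=0,\quad u_1=x,\quad b_1=Q(0,x),\qquad u_{n+1}=\lambda_1u_n+\lambda_1\lambda_2u_{n-1}-b_n,\quad b_{n+1}=Q(u_n,u_{n+1})\quad(n\ge1),$$ where $Q=Q_\alpha^\nu$ is a flaky 1-bit quantizer (defined in the context) with $\alpha\in\mathbb{R}$ and $\nu\ge0$. Suppose that the state sequence $(u_n)_{n\ge0}$ is bounded. Put $$\gamma=\frac{-\lambda_1+\sqrt{\lambda_1^2+4\lambda_1\lambda_2}}{2\lambda_1\lambda_2}.$$ Then for every integer $N\ge1$, $$\Big|x-\sum_{n=1}^{N}b_n\gamma^n\Big|\le C_\gamma\,\gamma^N,\qquad\text{where } C_\gamma=\frac{\gamma}{1-\gamma}.$$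
   Context: Flaky quantizer: for $\alpha\in\mathbb{R}$ and $\nu\ge 0$, $Q_\alpha^\nu(u,v)$ denotes a quantizer whose output is only known to satisfy: it equals $-1$ if $u+\alpha v<-\nu$; it equals $1$ if $u+\alpha v\ge\nu$; and it is an arbitrary element of $\{-1,1\}$ (possibly different at each use) if $-\nu\le u+\alpha v<\nu$. So "produced by" means that the sequences satisfy the recursion with each $b_{n+1}$ being some value allowed for $Q_\alpha^\nu(u_n,u_{n+1})$, and $b_1$ some value allowed for $Q_\alpha^\nu(0,x)$. *)

theory Defs
  imports Complex_Main
begin

(* The flaky quantizer is not a function: each use may return any of the admissible outputs. *)
definition flaky_quantizer :: "real \<Rightarrow> real \<Rightarrow> real \<Rightarrow> real \<Rightarrow> real set" where
  "flaky_quantizer \<alpha> \<nu> u v =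
     (if u + \<alpha> * v < - \<nu> then {-1}
      else if u + \<alpha> * v \<ge> \<nu> then {1}
      else {-1, 1})"

(* The bits are indexed from 1; the value b 0 is unconstrained and irrelevant. *)
definition leaky_golden_ratio_encoder ::
  "real \<Rightarrow> real \<Rightarrow> real \<Rightarrow> real \<Rightarrow> real \<Rightarrow> (nat \<Rightarrow> real) \<Rightarrow> (nat \<Rightarrow> real) \<Rightarrow> bool" where
  "leaky_golden_ratio_encoder l1 l2 \<alpha> \<nu> x u b \<longleftrightarrow>
     u 0 = 0 \<and> u 1 = x \<and> b 1 \<in> flaky_quantizer \<alpha> \<nu> 0 x \<and>
     (\<forall>n\<ge>1. u (n + 1) = l1 * u n + l1 * l2 * u (n - 1) - b n \<and>
             b (n + 1) \<in> flaky_quantizer \<alpha> \<nu> (u n) (u (n + 1)))"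

end

theory Submission
  imports Defs
begin

text \<open>
  The number \<open>\<gamma>\<close> is the positive root of \<open>l1 * l2 * \<gamma>\<^sup>2 + l1 * \<gamma> = 1\<close>, so the sum of the
  \<open>b n * \<gamma> ^ n\<close> telescopes: the error after \<open>N\<close> bits is \<open>\<gamma> ^ N * w N\<close> with
  \<open>w n = u (n + 1) + l1 * l2 * \<gamma> * u n\<close>. This sequence is bounded and satisfies
  \<open>w n = \<gamma> * (w (n + 1) + b (n + 1))\<close>. Unrolling this contraction towards infinity bounds
  \<open>\<bar>w n\<bar>\<close> by \<open>\<gamma> + \<gamma>\<^sup>2 + \<dots> = \<gamma> / (1 - \<gamma>)\<close>, independently of the bound on \<open>u\<close>.
\<close>

text \<open>\<open>\<gamma> / (1 - \<gamma>)\<close> is the fixed point of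
  \<open>t \<mapsto> \<gamma> * (t + 1)\<close>, so the excess of \<open>\<bar>w n\<bar>\<close>
  over it is at most \<open>\<gamma> ^ k\<close> times the excess at \<open>n + k\<close>.
  Boundedness makes this vanish as \<open>k\<close> grows.\<close>

lemma bounded_backward_contraction:
  fixes w :: "nat \<Rightarrow> real" and \<gamma> :: real
  assumes \<gamma>: "0 \<le> \<gamma>" "\<gamma> < 1"
    and step: "\<And>n. \<bar>w n\<bar> \<le> \<gamma> * (\<bar>w (Suc n)\<bar> + 1)"
    and "Bseq w"
  shows "\<bar>w n\<bar> \<le> \<gamma> / (1 - \<gamma>)"
proof -
  define C where "C = \<gamma> / (1 - \<gamma>)"
  have C: "\<gamma> * (C + 1) = C"
    using \<gamma> by (simp add: C_def field_simps)
  have step': "\<bar>w m\<bar> - C \<le> \<gamma> * (\<bar>w (Suc m)\<bar> - C)" for m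
    using step[of m] C by (simp add: algebra_simps)
  have iter: "\<bar>w n\<bar> - C \<le> \<gamma> ^ k * (\<bar>w (n + k)\<bar> - C)" for k
  proof (induction k)
    case (Suc k)
    have "\<gamma> ^ k * (\<bar>w (n + k)\<bar> - C) \<le> \<gamma> ^ k * (\<gamma> * (\<bar>w (Suc (n + k))\<bar> - C))"
      using step'[of "n + k"] \<gamma> by (intro mult_left_mono) auto
    with Suc show ?case
      by (simp add: mult_ac)
  qed simp
  obtain K where K: "\<And>m. \<bar>w m\<bar> \<le> K"
    using \<open>Bseq w\<close> by (auto simp: Bseq_def)
  \<comment> \<open>The uniform bound \<open>K\<close> removes the dependence on
    \<open>w (n + k)\<close>, so that \<open>k\<close> can tend to infinity.\<close>
  have "\<bar>w n\<bar> - C \<le> \<gamma> ^ k * (K - C)" for k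
  proof -
    have "\<gamma> ^ k * (\<bar>w (n + k)\<bar> - C) \<le> \<gamma> ^ k * (K - C)"
      using K[of "n + k"] \<gamma> by (intro mult_left_mono) auto
    with iter[of k] show ?thesis
      by linarith
  qed
  moreover have "(\<lambda>k. \<gamma> ^ k * (K - C)) \<longlonglongrightarrow> 0"
    using \<gamma> by (intro tendsto_mult_left_zero LIMSEQ_realpow_zero)
  ultimately have "\<bar>w n\<bar> - C \<le> 0"
    by (intro LIMSEQ_le_const) auto
  thus ?thesis
    by (simp add: C_def)
qed

text \<open>Completing the square gives the root equation. The condition \<open>p + q > 1\<close>
  makes \<open>p * t\<^sup>2 + q * t\<close> exceed 1 for every \<open>t \<ge> 1\<close>, which
  forces the root below 1.\<close>

lemma positive_quadratic_root:
  fixes p q :: real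
  assumes "p > 0" "q > 0" "p + q > 1"
  defines "\<gamma> \<equiv> (- q + sqrt (q\<^sup>2 + 4 * p)) / (2 * p)"
  shows "p * \<gamma>\<^sup>2 + q * \<gamma> = 1" "0 < \<gamma>" "\<gamma> < 1"
proof -
  define s where "s = sqrt (q\<^sup>2 + 4 * p)"
  have s2: "s\<^sup>2 = q\<^sup>2 + 4 * p"
    using assms by (simp add: s_def)
  have \<gamma>: "\<gamma> = (s - q) / (2 * p)"
    by (simp add: \<gamma>_def s_def)
  have "2 * p * \<gamma> + q = s"
    using assms(1) by (simp add: \<gamma>)
  hence "(2 * p * \<gamma> + q)\<^sup>2 = q\<^sup>2 + 4 * p"
    using s2 by simp
  hence "4 * p * (p * \<gamma>\<^sup>2 + q * \<gamma>) = 4 * p * 1"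
    by (simp add: power2_eq_square algebra_simps)
  thus root: "p * \<gamma>\<^sup>2 + q * \<gamma> = 1"
    using assms(1) by simp
  have "q < s"
    unfolding s_def using assms by (intro real_less_rsqrt) simp
  thus pos: "0 < \<gamma>"
    using assms(1) by (simp add: \<gamma>)
  show "\<gamma> < 1"
  proof (rule ccontr)
    assume "\<not> \<gamma> < 1"
    hence "p * 1 \<le> p * \<gamma>\<^sup>2" "q * 1 \<le> q * \<gamma>"
      using assms(1,2) by (intro mult_left_mono; simp)+
    with root assms(3) show False
      by simp
  qed
qed

lemma telescoping_error:
  fixes u b :: "nat \<Rightarrow> real" and p q \<gamma> :: real
  assumes "u 0 = 0"
    and rec: "\<And>n. u (Suc (Suc n)) = q * u (Suc n) + p * u n - b (Suc n)"
    and root: "p * \<gamma>\<^sup>2 + q * \<gamma> = 1"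
  shows "u 1 - (\<Sum>n=1..N. b n * \<gamma> ^ n) = \<gamma> ^ N * (u (Suc N) + p * \<gamma> * u N)"
proof (induction N)
  case 0
  show ?case using assms(1) by simp
next
  case (Suc N)
  \<comment> \<open>The recursion cancels the bit, and the two terms in \<open>u (Suc N)\<close>
    combine into the quadratic in \<open>\<gamma>\<close>, which equals 1.\<close>
  have "\<gamma> * (u (Suc (Suc N)) + p * \<gamma> * u (Suc N) + b (Suc N))
      = (p * \<gamma>\<^sup>2 + q * \<gamma>) * u (Suc N) + p * \<gamma> * u N"
    by (simp add: rec power2_eq_square algebra_simps)
  hence step: "u (Suc N) + p * \<gamma> * u N
      = \<gamma> * (u (Suc (Suc N)) + p * \<gamma> * u (Suc N) + b (Suc N))"
    by (simp add: root)
  have "u 1 - (\<Sum>n=1..Suc N. b n * \<gamma> ^ n)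
      = \<gamma> ^ N * (u (Suc N) + p * \<gamma> * u N) - b (Suc N) * \<gamma> ^ Suc N"
    using Suc by simp
  also have "\<dots> = \<gamma> ^ Suc N * (u (Suc (Suc N)) + p * \<gamma> * u (Suc N))"
    unfolding step by (simp add: algebra_simps)
  finally show ?case .
qed

theorem theorem2p1:
  fixes l1 l2 x \<alpha> \<nu> \<gamma> :: real and u b :: "nat \<Rightarrow> real"
  assumes "l1 \<in> {0.9..1}" and "l2 \<in> {0.9..1}" and "x \<in> {-1..1}"
    and "\<nu> \<ge> 0"
    and "leaky_golden_ratio_encoder l1 l2 \<alpha> \<nu> x u b"
    and "Bseq u"
    and "\<gamma> = (- l1 + sqrt (l1\<^sup>2 + 4 * l1 * l2)) / (2 * l1 * l2)"
  shows "\<forall>N\<ge>1. \<bar>x - (\<Sum>n=1..N. b n * \<gamma> ^ n)\<bar> \<le> \<gamma> / (1 - \<gamma>) * \<gamma> ^ N"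
proof (intro allI impI)
  fix N :: nat
  define p where "p = l1 * l2"
  define w where "w n = u (Suc n) + p * \<gamma> * u n" for n
  have u01: "u 0 = 0" "u 1 = x"
    and rec: "u (Suc (Suc n)) = l1 * u (Suc n) + p * u n - b (Suc n)" for n
    using assms(5) unfolding leaky_golden_ratio_encoder_def p_def
    by (auto dest!: spec[where x = "Suc n"])
  have bit: "\<bar>b (Suc n)\<bar> = 1" for n
  proof -
    have "b (Suc n) \<in> flaky_quantizer \<alpha> \<nu> (u n) (u (Suc n))"
      using assms(5) unfolding leaky_golden_ratio_encoder_def
      \<comment> \<open>The first bit has its own clause in the encoder, which fits the general
        pattern because \<open>u 0 = 0\<close> and \<open>u 1 = x\<close>.\<close>
      by (cases "n = 0") (auto dest!: spec[where x = n])
    thus ?thesis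
      by (auto simp: flaky_quantizer_def split: if_splits)
  qed
  \<comment> \<open>Since 0.81 + 0.9 > 1, this yields \<open>p + l1 > 1\<close> and hence
    \<open>\<gamma> < 1\<close>.\<close>
  have "0.9 * 0.9 \<le> p"
    unfolding p_def using assms(1,2) by (intro mult_mono) auto
  hence "p > 0" "l1 > 0" "p + l1 > 1"
    using assms(1) by auto
  note root = positive_quadratic_root[OF this, folded p_def]
  have "\<gamma> = (- l1 + sqrt (l1\<^sup>2 + 4 * p)) / (2 * p)"
    by (simp add: assms(7) p_def mult.assoc)
  with root have \<gamma>: "p * \<gamma>\<^sup>2 + l1 * \<gamma> = 1" "0 < \<gamma>" "\<gamma> < 1"
    by simp_all
  have error: "x - (\<Sum>n=1..N. b n * \<gamma> ^ n) = \<gamma> ^ N * w N" for N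
    using telescoping_error[OF u01(1) rec \<gamma>(1)] u01(2) by (simp add: w_def)
  \<comment> \<open>The errors after \<open>n\<close> and \<open>Suc n\<close> bits differ by the
    summand \<open>b (Suc n) * \<gamma> ^ Suc n\<close>; cancelling \<open>\<gamma> ^ n\<close>
    leaves this identity.\<close>
  have w_step: "w n = \<gamma> * (w (Suc n) + b (Suc n))" for n
  proof -
    have "\<gamma> ^ n * w n = \<gamma> ^ n * (\<gamma> * (w (Suc n) + b (Suc n)))"
      using error[of n] error[of "Suc n"] by (simp add: algebra_simps)
    thus ?thesis
      using \<gamma>(2) by simp
  qed
  have step: "\<bar>w n\<bar> \<le> \<gamma> * (\<bar>w (Suc n)\<bar> + 1)" for n
  proof -
    have "\<bar>w n\<bar> = \<gamma> * \<bar>w (Suc n) + b (Suc n)\<bar>"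
      using \<gamma>(2) by (subst w_step) (simp add: abs_mult)
    also have "\<dots> \<le> \<gamma> * (\<bar>w (Suc n)\<bar> + 1)"
      using \<gamma>(2) bit[of n] by (intro mult_left_mono) linarith+
    finally show ?thesis .
  qed
  obtain K where K: "\<And>n. \<bar>u n\<bar> \<le> K"
    using assms(6) by (auto simp: Bseq_def)
  have "\<bar>w n\<bar> \<le> K + p * \<gamma> * K" for n
  proof -
    have "\<bar>w n\<bar> \<le> \<bar>u (Suc n)\<bar> + p * \<gamma> * \<bar>u n\<bar>"
      using abs_triangle_ineq[of "u (Suc n)" "p * \<gamma> * u n"] \<gamma>(2) \<open>p > 0\<close>
      by (simp add: w_def abs_mult)
    also have "\<dots> \<le> K + p * \<gamma> * K"
      using K \<gamma>(2) \<open>p > 0\<close> by (intro add_mono mult_left_mono) auto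
    finally show ?thesis .
  qed
  hence "Bseq w"
    by (intro BseqI'[where K = "K + p * \<gamma> * K"]) simp
  with \<gamma> step have "\<bar>w N\<bar> \<le> \<gamma> / (1 - \<gamma>)"
    by (intro bounded_backward_contraction) auto
  hence "\<gamma> ^ N * \<bar>w N\<bar> \<le> \<gamma> ^ N * (\<gamma> / (1 - \<gamma>))"
    using \<gamma>(2) by (intro mult_left_mono) auto
  thus "\<bar>x - (\<Sum>n=1..N. b n * \<gamma> ^ n)\<bar> \<le> \<gamma> / (1 - \<gamma>) * \<gamma> ^ N"
    unfolding error using \<gamma>(2) by (simp add: abs_mult mult.commute)
qed

end
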